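(* Let $\phi=(1+\sqrt5)/2$. For a real $\alpha\neq0$ and a positive integer $m$, put $$Q(\alpha,m)=\frac{\sum_{n=1}^m\lfloor\alpha n\rfloor^3}{\bigl(\sum_{n=1}^m\lfloor\alpha n\rfloor\bigr)^2}.$$ For an integer $k\ge1$ put $m_k=F_k-1$. Then for every integer $k\ge 2$, $$Q(\phi^2,m_{2k})-Q(\phi,m_{2k})=\begin{cases}1-\dfrac{1}{(F_{k+1})^2L_{k+2}L_{k-1}} & \text{if $k$ is even},\\[5pt] 1-\dfrac{1}{(L_{k+1})^2F_{k+2}F_{k-1}} & \text{if $k$ is odd},\end{cases}$$ and $$Q(\phi^2,m_{2k-1})-Q(\phi,m_{2k-1})=\begin{cases}1-\dfrac{F_{k-2}}{F_{k+1}(F_k)^2(L_{k-1})^2} & \text{if $k$ is even},\\[5pt] 1-\dfrac{L_{k-2}}{L_{k+1}(L_k)^2(F_{k-1})^2} & \text{if $k$ is odd}.\end{cases}$$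
   Context: $\lfloor x\rfloor$ denotes the integer part of $x$. The Fibonacci numbers $F_n$ and Lucas numbers $L_n$ are defined by $F_0=0$, $F_1=1$, $L_0=2$, $L_1=1$ and $F_{n+2}=F_{n+1}+F_n$, $L_{n+2}=L_{n+1}+L_n$ for $n\ge0$. *)

theory Defs
  imports Complex_Main "HOL-Number_Theory.Fib"
begin

fun lucas :: "nat \<Rightarrow> nat" where
  "lucas 0 = 2"
| "lucas (Suc 0) = 1"
| "lucas (Suc (Suc n)) = lucas (Suc n) + lucas n"

definition golden_ratio :: real where
  "golden_ratio = (1 + sqrt 5) / 2"

text \<open>Only meant for \<open>\<alpha> \<noteq> 0\<close> and \<open>m > 0\<close>; a vanishing denominator gives the value \<open>0\<close>.\<close>

definition Q :: "real \<Rightarrow> nat \<Rightarrow> real" where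
  "Q \<alpha> m = (\<Sum>n=1..m. real_of_int \<lfloor>\<alpha> * real n\<rfloor> ^ 3)
            / (\<Sum>n=1..m. real_of_int \<lfloor>\<alpha> * real n\<rfloor>) ^ 2"

text \<open>The subtraction is on natural numbers; it is exact for \<open>k \<ge> 1\<close>, since then \<open>fib k \<ge> 1\<close>.\<close>

definition fib_pred :: "nat \<Rightarrow> nat" where
  "fib_pred k = fib k - 1"

end

theory Submission
  imports Defs
begin

text \<open>
  The distance from \<open>golden_ratio * fib (N + 1)\<close> to the integer \<open>fib (N + 2)\<close> is so small that for
  \<open>0 < m < fib N\<close> adding it to \<open>golden_ratio * m\<close> does not change the integer part. Hence
  \<open>\<lfloor>golden_ratio * n\<rfloor>\<close> on the block from \<open>fib (N + 1)\<close> to \<open>fib (N + 2)\<close> is a translate of its values below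
  \<open>fib N\<close>, except at the left end for odd \<open>N\<close>. So the sums of \<open>n\<^sup>i \<lfloor>golden_ratio * n\<rfloor>\<^sup>j\<close> over
  \<open>n < fib N\<close> satisfy a Fibonacci-type recurrence, which yields closed forms in \<open>fib N\<close>,
  \<open>fib (N + 1)\<close> and \<open>(-1)\<^sup>N\<close>. Since \<open>\<lfloor>golden_ratio\<^sup>2 * n\<rfloor> = \<lfloor>golden_ratio * n\<rfloor> + n\<close>, these determine
  both quotients, and expressing everything through \<open>fib k\<close> and \<open>fib (k + 1)\<close> makes the
  numerators and denominators factor.
\<close>

definition wythoff :: "nat \<Rightarrow> real" where
  "wythoff n = real_of_int \<lfloor>golden_ratio * real n\<rfloor>"

text \<open>Two exponents, because cubing \<open>wythoff n + real n\<close> produces mixed terms;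
  the strict bound \<open>n < fib N\<close> matches summation up to
  \<open>fib_pred N\<close>.\<close>

definition moment :: "nat \<Rightarrow> nat \<Rightarrow> nat \<Rightarrow> real" where
  "moment i j N = (\<Sum>n<fib N. real n ^ i * wythoff n ^ j)"

subsection \<open>The lower Wythoff sequence along a Fibonacci shift\<close>

lemma golden_ratio_square: "golden_ratio ^ 2 = golden_ratio + 1"
  by (simp add: golden_ratio_def power2_eq_square field_simps)

lemma golden_ratio_bounds: "1 < golden_ratio" "golden_ratio < 2"
proof -
  have "sqrt 5 > 1" by simp
  moreover have "sqrt 5 < 3" by (rule real_less_lsqrt) auto
  ultimately show "1 < golden_ratio" "golden_ratio < 2" by (simp_all add: golden_ratio_def)
qed

text \<open>The conjugate root \<open>1 - golden_ratio\<close> satisfies the same quadratic equation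
  as \<open>golden_ratio\<close>, so the error term obeys the Fibonacci recurrence.\<close>

lemma golden_ratio_fib:
  "golden_ratio * real (fib n) = real (fib (Suc n)) - (1 - golden_ratio) ^ n"
proof (induction n rule: fib.induct)
  case (3 n)
  have "(1 - golden_ratio) ^ Suc (Suc n) = (1 - golden_ratio) ^ n * (1 - golden_ratio) ^ 2"
    by (simp add: power2_eq_square)
  also have "(1 - golden_ratio) ^ 2 = 1 + (1 - golden_ratio)"
    using golden_ratio_square by algebra
  finally show ?case using 3 by (simp add: algebra_simps)
qed auto

lemma conj_power: "(1 - golden_ratio) ^ n = (if even n then 1 else -1) * (golden_ratio - 1) ^ n"
proof -
  have "(1 - golden_ratio) ^ n = (-1) ^ n * (golden_ratio - 1) ^ n"
    by (simp flip: power_mult_distrib)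
  then show ?thesis by simp
qed

text \<open>With this relation and positivity, \<open>linarith\<close> can compare powers of
  \<open>golden_ratio - 1\<close> while treating them as atoms; in particular it sees that they
  decrease.\<close>

lemma golden_ratio_minus_1_power_rec:
  "(golden_ratio - 1) ^ Suc (Suc n) = (golden_ratio - 1) ^ n - (golden_ratio - 1) ^ Suc n"
proof -
  have "(golden_ratio - 1) ^ 2 = 1 - (golden_ratio - 1)"
    using golden_ratio_square by algebra
  then have "(golden_ratio - 1) ^ n * (golden_ratio - 1) ^ 2
      = (golden_ratio - 1) ^ n * (1 - (golden_ratio - 1))"
    by simp
  then show ?thesis by (simp add: power2_eq_square algebra_simps)
qed

lemma golden_ratio_minus_1_power_pos: "0 < (golden_ratio - 1) ^ n"
  using golden_ratio_bounds by simp

text \<open>Best approximation: no multiple of \<open>golden_ratio\<close> with a factor below \<open>fib (n + 1)\<close>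
  comes closer to an integer than \<open>golden_ratio * fib n\<close> does.\<close>

lemma golden_ratio_mult_dist_int:
  "0 < m \<Longrightarrow> m < fib (Suc n) \<Longrightarrow>
   \<exists>j::int. of_int j + (golden_ratio - 1) ^ n \<le> golden_ratio * real m \<and>
            golden_ratio * real m \<le> of_int j + 1 - (golden_ratio - 1) ^ n"
proof (induction n arbitrary: m rule: less_induct)
  case (less N)
  let ?t = "golden_ratio - 1"
  show ?case
  proof (cases "N < 2")
    \<comment> \<open>Vacuous, since \<open>fib 1 = fib 2 = 1\<close> leaves no room for
      \<open>m\<close>.\<close>
    case True
    with less.prems have False by (cases N) (auto simp: less_Suc_eq)
    then show ?thesis ..
  next
    case False
    then obtain n where N: "N = Suc (Suc n)" by (metis add_2_eq_Suc le_Suc_ex not_less)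
    note rec = golden_ratio_minus_1_power_rec[of n] golden_ratio_minus_1_power_rec[of "Suc n"]
    note pos = golden_ratio_minus_1_power_pos[of n] golden_ratio_minus_1_power_pos[of "Suc n"]
      golden_ratio_minus_1_power_pos[of "Suc (Suc n)"] golden_ratio_minus_1_power_pos[of "Suc (Suc (Suc n))"]
    consider "m < fib (Suc (Suc n))" | "m = fib (Suc (Suc n))" | "m > fib (Suc (Suc n))"
      by linarith
    then show ?thesis
    proof cases
      case 1
      then obtain j :: int where "of_int j + ?t ^ Suc n \<le> golden_ratio * real m"
          "golden_ratio * real m \<le> of_int j + 1 - ?t ^ Suc n"
        using less.IH[of "Suc n" m] less.prems N by auto
      then show ?thesis using rec pos unfolding N
        by (intro exI[of _ j]) linarith
    next
      \<comment> \<open>Here one of the two distances is exactly \<open>?t ^ Suc (Suc n)\<close>;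
        the other is large enough once this power is at most 1/2.\<close>
      case 2
      have eq: "golden_ratio * real m
          = real (fib (Suc (Suc (Suc n)))) - (if even n then 1 else -1) * ?t ^ Suc (Suc n)"
        unfolding 2 golden_ratio_fib[of "Suc (Suc n)"] conj_power by simp
      have "?t ^ Suc n \<le> ?t" using golden_ratio_bounds power_decreasing[of 1 "Suc n" ?t] by simp
      moreover have "?t ^ n \<le> 1" using golden_ratio_bounds by (simp add: power_le_one)
      moreover have "?t ^ Suc (Suc n) \<le> ?t ^ 2"
        using golden_ratio_bounds by (intro power_decreasing) auto
      moreover have "?t ^ 2 = 1 - ?t" using golden_ratio_square by algebra
      moreover have "?t \<ge> 1/2"
      proof -
        have "sqrt 5 \<ge> 2" by (rule real_le_rsqrt) auto
        then show ?thesis by (simp add: golden_ratio_def)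
      qed
      ultimately have half: "2 * ?t ^ Suc (Suc n) \<le> 1" by linarith
      show ?thesis
      proof (cases "even n")
        \<comment> \<open>For even \<open>n\<close> the product lies just below
          \<open>fib (n + 3)\<close>, so the integer to its left is one less.\<close>
        case True
        with eq half pos show ?thesis unfolding N
          by (intro exI[of _ "int (fib (Suc (Suc (Suc n)))) - 1"])
             (simp only: of_int_diff of_int_of_nat_eq if_True of_int_1; linarith)
      next
        case False
        with eq half pos show ?thesis unfolding N
          by (intro exI[of _ "int (fib (Suc (Suc (Suc n))))"])
             (simp only: of_int_of_nat_eq if_False; linarith)
      qed
    next
      \<comment> \<open>The remainder \<open>m'\<close> has margin \<open>?t ^ n\<close>. The shift
        costs at most \<open>?t ^ Suc (Suc n)\<close>, which leaves \<open>?t ^ Suc n\<close>, more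
        than required.\<close>
      case 3
      define m' where "m' = m - fib (Suc (Suc n))"
      have m: "m = fib (Suc (Suc n)) + m'" and "0 < m'" "m' < fib (Suc n)"
        using 3 less.prems N by (auto simp: m'_def)
      then obtain j :: int where j: "of_int j + ?t ^ n \<le> golden_ratio * real m'"
          "golden_ratio * real m' \<le> of_int j + 1 - ?t ^ n"
        using less.IH[of n m'] N by auto
      have "golden_ratio * real m = real (fib (Suc (Suc (Suc n))))
          - (if even n then 1 else -1) * ?t ^ Suc (Suc n) + golden_ratio * real m'"
        unfolding m of_nat_add distrib_left golden_ratio_fib[of "Suc (Suc n)"] conj_power by simp
      then have "golden_ratio * real m \<le> real (fib (Suc (Suc (Suc n)))) + ?t ^ Suc (Suc n)
            + golden_ratio * real m'"
          "golden_ratio * real m \<ge> real (fib (Suc (Suc (Suc n)))) - ?t ^ Suc (Suc n)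
            + golden_ratio * real m'"
        using pos by (auto split: if_splits)
      with j rec pos show ?thesis unfolding N
        by (intro exI[of _ "int (fib (Suc (Suc (Suc n)))) + j"])
           (simp only: of_int_add of_int_of_nat_eq; linarith)
    qed
  qed
qed

lemma wythoff_0: "wythoff 0 = 0"
  by (simp add: wythoff_def)

text \<open>The shift error has absolute value \<open>(golden_ratio - 1) ^ (N + 1)\<close>, less
  than the margin \<open>(golden_ratio - 1) ^ (N - 1)\<close> around
  \<open>golden_ratio * m\<close>. For \<open>m = 0\<close> there is no margin, and
  \<open>wythoff_fib\<close> takes over.\<close>

lemma wythoff_fib_add:
  assumes "0 < m" "m < fib N"
  shows "wythoff (fib (Suc N) + m) = real (fib (Suc (Suc N))) + wythoff m"
proof -
  let ?t = "golden_ratio - 1"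
  obtain n where N: "N = Suc n" using assms by (cases N) auto
  obtain j :: int where j: "of_int j + ?t ^ n \<le> golden_ratio * real m"
      "golden_ratio * real m \<le> of_int j + 1 - ?t ^ n"
    using golden_ratio_mult_dist_int assms N by blast
  note rec = golden_ratio_minus_1_power_rec[of n]
  note pos = golden_ratio_minus_1_power_pos[of n] golden_ratio_minus_1_power_pos[of "Suc n"]
    golden_ratio_minus_1_power_pos[of "Suc (Suc n)"]
  have "golden_ratio * real (fib (Suc N) + m) = real (fib (Suc (Suc N)))
      - (if even n then 1 else -1) * ?t ^ Suc (Suc n) + golden_ratio * real m"
    unfolding N of_nat_add distrib_left golden_ratio_fib[of "Suc (Suc n)"] conj_power by simp
  then have "golden_ratio * real (fib (Suc N) + m) \<le> real (fib (Suc (Suc N))) + ?t ^ Suc (Suc n)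
        + golden_ratio * real m"
      "golden_ratio * real (fib (Suc N) + m) \<ge> real (fib (Suc (Suc N))) - ?t ^ Suc (Suc n)
        + golden_ratio * real m"
    using pos by (auto split: if_splits)
  with j rec pos have "\<lfloor>golden_ratio * real (fib (Suc N) + m)\<rfloor> = int (fib (Suc (Suc N))) + j"
    by (intro floor_unique; simp only: of_int_add of_int_of_nat_eq; linarith)
  moreover from j pos have "\<lfloor>golden_ratio * real m\<rfloor> = j"
    by (intro floor_unique; linarith)
  ultimately show ?thesis by (simp only: wythoff_def of_int_add of_int_of_nat_eq)
qed

lemma wythoff_fib:
  "wythoff (fib (Suc N)) = real (fib (Suc (Suc N))) - (if odd N then 1 else 0)"
proof -
  let ?t = "golden_ratio - 1"
  have pos: "0 < ?t ^ Suc N" by (rule golden_ratio_minus_1_power_pos)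
  have "?t ^ Suc N \<le> ?t" using golden_ratio_bounds power_decreasing[of 1 "Suc N" ?t] by simp
  then have lt: "?t ^ Suc N < 1" using golden_ratio_bounds by linarith
  have eq: "golden_ratio * real (fib (Suc N))
      = real (fib (Suc (Suc N))) - (if odd N then 1 else -1) * ?t ^ Suc N"
    unfolding golden_ratio_fib[of "Suc N"] conj_power by simp
  have "\<lfloor>golden_ratio * real (fib (Suc N))\<rfloor> = int (fib (Suc (Suc N))) - (if odd N then 1 else 0)"
  proof (cases "even N")
    case True
    with eq pos lt show ?thesis
      by (intro floor_unique;
          simp only: if_True if_False simp_thms of_int_diff of_int_of_nat_eq of_int_1; linarith)
  next
    case False
    with eq pos lt show ?thesis
      by (intro floor_unique;
          simp only: if_True if_False simp_thms of_int_diff of_int_of_nat_eq of_int_0; linarith)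
  qed
  then show ?thesis by (simp add: wythoff_def)
qed

subsection \<open>Power moments up to a Fibonacci number\<close>

lemma sum_lessThan_add:
  fixes h :: "nat \<Rightarrow> 'a::comm_monoid_add"
  shows "(\<Sum>n<p + q. h n) = (\<Sum>n<p. h n) + (\<Sum>n<q. h (p + n))"
  by (induction q) (simp_all add: add.assoc)

lemma small_binomial_sum:
  "{..1::nat} = {0, 1}" "{..2::nat} = {0, 1, 2}" "{..3::nat} = {0, 1, 2, 3}"
  "(2::nat) choose 1 = 2" "(3::nat) choose 1 = 3" "(3::nat) choose 2 = 3"
  by (auto simp: eval_nat_numeral)

text \<open>Expanding both binomials involves only moments with \<open>p \<le> i\<close> and
  \<open>q \<le> j\<close>, so closed forms can be found in order of increasing exponents.\<close>

lemma sum_shift_moment: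
  "(\<Sum>n<fib N. (a + real n) ^ i * (b + wythoff n) ^ j)
   = (\<Sum>p\<le>i. \<Sum>q\<le>j. real (i choose p) * a ^ (i - p) * (real (j choose q) * b ^ (j - q))
        * moment p q N)"
proof -
  have "(a + real n) ^ i * (b + wythoff n) ^ j
      = (\<Sum>p\<le>i. \<Sum>q\<le>j. real (i choose p) * a ^ (i - p) * (real (j choose q) * b ^ (j - q))
          * (real n ^ p * wythoff n ^ q))" for n
    by (simp add: add.commute[of a] add.commute[of b] binomial_ring sum_product mult_ac)
  then show ?thesis
    by (simp add: moment_def sum_distrib_left sum.swap[of _ "{..<fib N}"])
qed

text \<open>The last summand corrects the term for \<open>n = fib (N + 1)\<close>, where \<open>golden_ratio * n\<close>
  lies just below the integer \<open>fib (N + 2)\<close> if \<open>N\<close> is odd.\<close>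

lemma moment_rec:
  fixes x y :: real
  assumes "N \<ge> 1"
  defines "x \<equiv> real (fib N)" and "y \<equiv> real (fib (Suc N))"
  shows "moment i j (Suc (Suc N)) = moment i j (Suc N)
    + (\<Sum>p\<le>i. \<Sum>q\<le>j. real (i choose p) * y ^ (i - p) * (real (j choose q) * (x + y) ^ (j - q))
         * moment p q N)
    + (1 - (-1) ^ N) / 2 * (y ^ i * ((x + y - 1) ^ j - (x + y) ^ j))"
proof -
  let ?x = "real (fib N)" and ?y = "real (fib (Suc N))"
  have pos: "0 < fib N" using assms by (simp add: fib_neq_0_nat)
  have shift: "wythoff (fib (Suc N) + n) = ?x + ?y + wythoff n" if "1 \<le> n" "n < fib N" for n
    using wythoff_fib_add[of n N] that by simp
  from pos have split: "{..<fib N} = insert 0 {1..<fib N}" by auto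
  have "(\<Sum>n<fib N. real (fib (Suc N) + n) ^ i * wythoff (fib (Suc N) + n) ^ j)
      = ?y ^ i * wythoff (fib (Suc N)) ^ j
        + (\<Sum>n=1..<fib N. real (fib (Suc N) + n) ^ i * wythoff (fib (Suc N) + n) ^ j)"
    unfolding split by simp
  also have "(\<Sum>n=1..<fib N. real (fib (Suc N) + n) ^ i * wythoff (fib (Suc N) + n) ^ j)
      = (\<Sum>n=1..<fib N. (?y + real n) ^ i * (?x + ?y + wythoff n) ^ j)"
    by (intro sum.cong) (simp_all add: shift)
  \<comment> \<open>The translated value at \<open>n = 0\<close> is put back and subtracted.
    Comparison with \<open>wythoff_fib\<close> leaves the correction, where
    \<open>(1 - (-1) ^ N) / 2\<close> is the indicator of odd \<open>N\<close>.\<close>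
  also have "\<dots> = (\<Sum>n<fib N. (?y + real n) ^ i * (?x + ?y + wythoff n) ^ j) - ?y ^ i * (?x + ?y) ^ j"
    unfolding split by (simp add: wythoff_0)
  finally show ?thesis
    unfolding x_def y_def sum_shift_moment[symmetric]
    using sum_lessThan_add[of "\<lambda>n. real n ^ i * wythoff n ^ j" "fib (Suc N)" "fib N"]
    by (auto simp: moment_def wythoff_fib right_diff_distrib add.commute)
qed

section \<open>Closed forms of the moments\<close>

lemma fib_cassini_real:
  "real (fib (Suc n)) ^ 2 = real (fib n) * real (fib (Suc n)) + real (fib n) ^ 2 + (-1) ^ n"
proof (induction n)
  case (Suc n)
  then show ?case by (simp add: power2_eq_square algebra_simps)
qed simp

text \<open>Fitted to \<open>moment_rec\<close>, which reaches back two indices and starts at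
  \<open>N = 1\<close>.\<close>

lemma nat_two_step_induct [consumes 1, case_names 1 2 step]:
  assumes "N \<ge> 1" "P 1" "P 2"
    and "\<And>n. n \<ge> 1 \<Longrightarrow> P n \<Longrightarrow> P (Suc n) \<Longrightarrow> P (Suc (Suc n))"
  shows "P (N::nat)"
  using assms(1)
proof (induction N rule: fib.induct)
  case (3 n)
  then show ?case using assms(2-4) by (cases "n = 0") (auto simp: numeral_2_eq_2)
qed (use assms in auto)

text \<open>The closed forms are linear in \<open>a\<close> because \<open>a\<^sup>2 = a * b + b\<^sup>2 + e\<close>; their coefficients
  were found by interpolation.\<close>

lemma moment_0_0: "moment 0 0 N = real (fib N)"
  by (simp add: moment_def)

lemma moment_1_0: "moment 1 0 N = (let b = real (fib N) in (-b + b^2) / 2)"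
proof -
  have "(\<Sum>n<m. real n ^ 1) = (let b = real m in (-b + b^2) / 2)" for m
    by (induction m) (simp_all add: Let_def field_simps power2_eq_square power3_eq_cube
        power4_eq_xxxx)
  then show ?thesis by (simp add: moment_def)
qed

lemma moment_0_1:
  assumes "N \<ge> 1"
  shows "moment 0 1 N = (let a = real (fib (Suc N)); b = real (fib N) in
    (1 - b - a + a*b) / 2)"
  using assms
proof (induction N rule: nat_two_step_induct)
  case (step N)
  \<comment> \<open>With these three atoms the induction step is a polynomial identity modulo
    Cassini's relation and \<open>e ^ 2 = 1\<close>.\<close>
  obtain x y e where xye: "real (fib N) = x" "real (fib (Suc N)) = y" "(-1) ^ N = (e::real)"
    by blast
  have "y ^ 2 = x * y + x ^ 2 + e" using fib_cassini_real[of N] by (simp add: xye)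
  moreover have "e ^ 2 = 1" by (simp flip: xye power_mult)
  ultimately show ?case
    by (simp add: moment_rec[OF step(1)] step(2,3) moment_0_0 small_binomial_sum xye Let_def field_simps del: One_nat_def) algebra
qed (simp_all add: moment_def wythoff_0 Let_def numeral_2_eq_2)

lemma moment_2_0: "moment 2 0 N = (let b = real (fib N) in (b - 3*b^2 + 2*b^3) / 6)"
proof -
  have "(\<Sum>n<m. real n ^ 2) = (let b = real m in (b - 3*b^2 + 2*b^3) / 6)" for m
    by (induction m) (simp_all add: Let_def field_simps power2_eq_square power3_eq_cube
        power4_eq_xxxx)
  then show ?thesis by (simp add: moment_def)
qed

lemma moment_1_1:
  assumes "N \<ge> 1"
  shows "moment 1 1 N = (let a = real (fib (Suc N)); b = real (fib N); e = (-1) ^ N in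
    (5*b + 2*e*b - 3*b^2 + a - e*a - 6*a*b + 4*a*b^2) / 12)"
  using assms
proof (induction N rule: nat_two_step_induct)
  case (step N)
  obtain x y e where xye: "real (fib N) = x" "real (fib (Suc N)) = y" "(-1) ^ N = (e::real)"
    by blast
  have "y ^ 2 = x * y + x ^ 2 + e" using fib_cassini_real[of N] by (simp add: xye)
  moreover have "e ^ 2 = 1" by (simp flip: xye power_mult)
  ultimately show ?case
    by (simp add: moment_rec[OF step(1)] step(2,3) moment_0_1[OF step(1)] moment_1_0 moment_0_0
        small_binomial_sum xye Let_def field_simps del: One_nat_def) algebra
qed (simp_all add: moment_def wythoff_0 Let_def numeral_2_eq_2)

lemma moment_0_2:
  assumes "N \<ge> 1"
  shows "moment 0 2 N = (let a = real (fib (Suc N)); b = real (fib N); e = (-1) ^ N in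
    (-3 - 3*e + 2*b + e*b - 3*b^2 + 2*b^3 + 5*a + e*a - 6*a*b + 2*a*b^2) / 6)"
  using assms
proof (induction N rule: nat_two_step_induct)
  case (step N)
  obtain x y e where xye: "real (fib N) = x" "real (fib (Suc N)) = y" "(-1) ^ N = (e::real)"
    by blast
  have "y ^ 2 = x * y + x ^ 2 + e" using fib_cassini_real[of N] by (simp add: xye)
  moreover have "e ^ 2 = 1" by (simp flip: xye power_mult)
  ultimately show ?case
    by (simp add: moment_rec[OF step(1)] step(2,3) moment_0_1[OF step(1)] moment_0_0
        small_binomial_sum xye Let_def field_simps del: One_nat_def) algebra
qed (simp_all add: moment_def wythoff_0 Let_def numeral_2_eq_2)

lemma moment_3_0: "moment 3 0 N = (let b = real (fib N) in (b^2 - 2*b^3 + b^4) / 4)"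
proof -
  have "(\<Sum>n<m. real n ^ 3) = (let b = real m in (b^2 - 2*b^3 + b^4) / 4)" for m
    by (induction m) (simp_all add: Let_def field_simps power2_eq_square power3_eq_cube
        power4_eq_xxxx)
  then show ?thesis by (simp add: moment_def)
qed

lemma moment_2_1:
  assumes "N \<ge> 1"
  shows "moment 2 1 N = (let a = real (fib (Suc N)); b = real (fib N); e = (-1) ^ N in
    (-b + 5*b^2 + 2*e*b^2 - 2*b^3 + 2*a*b - e*a*b - 6*a*b^2 + 3*a*b^3) / 12)"
  using assms
proof (induction N rule: nat_two_step_induct)
  case (step N)
  obtain x y e where xye: "real (fib N) = x" "real (fib (Suc N)) = y" "(-1) ^ N = (e::real)"
    by blast
  have "y ^ 2 = x * y + x ^ 2 + e" using fib_cassini_real[of N] by (simp add: xye)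
  moreover have "e ^ 2 = 1" by (simp flip: xye power_mult)
  ultimately show ?case
    by (simp add: moment_rec[OF step(1)] step(2,3) moment_0_1[OF step(1)] moment_1_0
        moment_1_1[OF step(1)] moment_2_0 moment_0_0 small_binomial_sum xye Let_def field_simps del: One_nat_def) algebra
qed (simp_all add: moment_def wythoff_0 Let_def numeral_2_eq_2)

lemma moment_1_2:
  assumes "N \<ge> 1"
  shows "moment 1 2 N = (let a = real (fib (Suc N)); b = real (fib N); e = (-1) ^ N in
    (-1 + e - 5*b - 8*e*b + 3*b^2 + e*b^2 - 6*b^3 + 3*b^4 - a + e*a + 11*a*b + 2*e*a*b
      - 10*a*b^2 + 3*a*b^3) / 12)"
  using assms
proof (induction N rule: nat_two_step_induct)
  case (step N)
  obtain x y e where xye: "real (fib N) = x" "real (fib (Suc N)) = y" "(-1) ^ N = (e::real)"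
    by blast
  have "y ^ 2 = x * y + x ^ 2 + e" using fib_cassini_real[of N] by (simp add: xye)
  moreover have "e ^ 2 = 1" by (simp flip: xye power_mult)
  ultimately show ?case
    by (simp add: moment_rec[OF step(1)] step(2,3) moment_0_1[OF step(1)] moment_0_2[OF step(1)]
        moment_1_0 moment_1_1[OF step(1)] moment_0_0 small_binomial_sum xye Let_def field_simps del: One_nat_def) algebra
qed (simp_all add: moment_def wythoff_0 Let_def numeral_2_eq_2)

lemma moment_0_3:
  assumes "N \<ge> 1"
  shows "moment 0 3 N = (let a = real (fib (Suc N)); b = real (fib N); e = (-1) ^ N in
    (3 + 5*e - b - 3*e*b + 5*b^2 + 2*e*b^2 - 4*b^3 + b^4 - 5*a - 3*e*a + 7*a*b + e*a*b - 6*a*b^2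
      + 2*a*b^3) / 4)"
  using assms
proof (induction N rule: nat_two_step_induct)
  case (step N)
  obtain x y e where xye: "real (fib N) = x" "real (fib (Suc N)) = y" "(-1) ^ N = (e::real)"
    by blast
  have "y ^ 2 = x * y + x ^ 2 + e" using fib_cassini_real[of N] by (simp add: xye)
  moreover have "e ^ 2 = 1" by (simp flip: xye power_mult)
  ultimately show ?case
    by (simp add: moment_rec[OF step(1)] step(2,3) moment_0_1[OF step(1)] moment_0_2[OF step(1)]
        moment_0_0 small_binomial_sum xye Let_def field_simps del: One_nat_def) algebra
qed (simp_all add: moment_def wythoff_0 Let_def numeral_2_eq_2)

subsection \<open>The quotients at Fibonacci indices\<close>

lemma Q_golden_ratio:
  assumes "N \<ge> 1"
  shows "Q golden_ratio (fib_pred N) = moment 0 3 N / moment 0 1 N ^ 2"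
proof -
  \<comment> \<open>Omitting \<open>n = 0\<close> is harmless, because
    \<open>wythoff 0 = 0\<close>.\<close>
  have "{1..fib N - 1} = {..<fib N} - {0}" using assms by auto
  then show ?thesis
    by (simp add: Q_def fib_pred_def moment_def wythoff_def sum_diff1)
qed

lemma Q_golden_ratio_square:
  assumes "N \<ge> 1"
  shows "Q (golden_ratio ^ 2) (fib_pred N)
    = (moment 0 3 N + 3 * moment 1 2 N + 3 * moment 2 1 N + moment 3 0 N)
      / (moment 0 1 N + moment 1 0 N) ^ 2"
proof -
  have floor: "real_of_int \<lfloor>golden_ratio ^ 2 * real n\<rfloor> = wythoff n + real n" for n
  proof -
    have "golden_ratio ^ 2 * real n = golden_ratio * real n + of_int (int n)"
      by (simp add: golden_ratio_square algebra_simps)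
    then show ?thesis by (simp only: wythoff_def floor_add_int[symmetric])
  qed
  have "{1..fib N - 1} = {..<fib N} - {0}" using assms by auto
  then have "Q (golden_ratio ^ 2) (fib_pred N)
      = (\<Sum>n<fib N. (wythoff n + real n) ^ 3) / (\<Sum>n<fib N. wythoff n + real n) ^ 2"
    unfolding Q_def fib_pred_def floor by (simp add: sum_diff1 wythoff_0)
  also have "(\<Sum>n<fib N. wythoff n + real n) = moment 0 1 N + moment 1 0 N"
    by (simp add: moment_def sum.distrib)
  also have "(\<Sum>n<fib N. (wythoff n + real n) ^ 3)
      = moment 0 3 N + 3 * moment 1 2 N + 3 * moment 2 1 N + moment 3 0 N"
    unfolding moment_def sum_distrib_left sum.distrib[symmetric]
    by (intro sum.cong refl) algebra
  finally show ?thesis .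
qed

text \<open>In the next four lemmas \<open>x = fib k\<close> and \<open>y = fib (k + 1)\<close>, with \<open>N = 2 * k\<close> or
  \<open>N = 2 * k - 1\<close>. The factorizations come from making the closed forms of the moments
  homogeneous in \<open>x\<close> and \<open>y\<close> by means of Cassini's identity.\<close>

lemma Q_diff_even_even:
  fixes x y :: real
  assumes N: "N \<ge> 1" "even N"
    and b: "real (fib N) = x * (2 * y - x)" and a: "real (fib (Suc N)) = x ^ 2 + y ^ 2"
    and cassini: "y ^ 2 = x * y + x ^ 2 + 1"
    and nz: "x > 0" "y > 0" "2 * x + y > 0" "x + 3 * y > 0" "3 * x - y > 0"
  shows "Q (golden_ratio ^ 2) (fib_pred N) - Q golden_ratio (fib_pred N)
    = 1 - 1 / (y ^ 2 * (x + 3 * y) * (3 * x - y))"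
proof -
  \<comment> \<open>For \<open>x = fib k\<close> these are the Lucas numbers with indices
    \<open>k + 1\<close>, \<open>k + 2\<close> and \<open>k - 1\<close>. The lemma name gives the
    parity of \<open>N\<close>, then that of \<open>k\<close>, which fixes the sign in
    \<open>cassini\<close>.\<close>
  obtain g h d where f: "g = 2 * x + y" "h = x + 3 * y" "d = 3 * x - y" by blast
  have nz': "x > 0" "y > 0" "g > 0" "h > 0" "d > 0" using nz f by simp_all
  note closed = Let_def N a b f
  have m01: "moment 0 1 N = x * y * g * d / 2"
    using cassini by (simp add: moment_0_1 closed field_simps del: One_nat_def) algebra
  have m03: "moment 0 3 N = x ^ 4 * g ^ 2 * d * h / 4"
    using cassini by (simp add: moment_0_3 closed field_simps del: One_nat_def) algebra
  have Q1: "Q golden_ratio (fib_pred N) = (x ^ 2 * h) / (y ^ 2 * d)"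
    unfolding Q_golden_ratio[OF N(1)] m01 m03 using nz'
    by (simp add: field_simps power2_eq_square power4_eq_xxxx)
  have denominator: "moment 0 1 N + moment 1 0 N = x * y * d * h / 2"
    using cassini by (simp add: moment_0_1 moment_1_0 closed field_simps del: One_nat_def) algebra
  \<comment> \<open>The cubic is the cofactor left after removing the factors that cancel against
    the squared denominator.\<close>
  have numerator: "moment 0 3 N + 3 * moment 1 2 N + 3 * moment 2 1 N + moment 3 0 N
      = x ^ 2 * y * d * h * (4 * x ^ 3 + 13 * x ^ 2 * y + 10 * x * y ^ 2 - 4 * y ^ 3) / 4"
    using cassini
    by (simp add: moment_0_3 moment_1_2 moment_2_1 moment_3_0 closed field_simps del: One_nat_def) algebra
  have Q2: "Q (golden_ratio ^ 2) (fib_pred N)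
      = (4 * x ^ 3 + 13 * x ^ 2 * y + 10 * x * y ^ 2 - 4 * y ^ 3) / (y * d * h)"
    unfolding Q_golden_ratio_square[OF N(1)] denominator numerator using nz'
    by (simp add: field_simps power2_eq_square)
  \<comment> \<open>The claim with all denominators cleared, a polynomial identity modulo
    \<open>cassini\<close>.\<close>
  have "(4 * x ^ 3 + 13 * x ^ 2 * y + 10 * x * y ^ 2 - 4 * y ^ 3) * (y ^ 2 * d) * (y ^ 2 * h * d)
      - (x ^ 2 * h) * (y * d * h) * (y ^ 2 * h * d)
      = (y * d * h) * (y ^ 2 * d) * (y ^ 2 * h * d - 1)"
    using cassini f by algebra
  then show ?thesis
    unfolding Q1 Q2 f[symmetric] using nz' by (simp add: field_simps)
qed

lemma Q_diff_odd_even: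
  fixes x y :: real
  assumes N: "N \<ge> 1" "odd N"
    and b: "real (fib N) = x ^ 2 + (y - x) ^ 2" and a: "real (fib (Suc N)) = x * (2 * y - x)"
    and cassini: "y ^ 2 = x * y + x ^ 2 + 1"
    and nz: "x > 0" "y > 0" "2 * x + y > 0" "3 * x - y > 0"
  shows "Q (golden_ratio ^ 2) (fib_pred N) - Q golden_ratio (fib_pred N)
    = 1 - (2 * x - y) / (y * x ^ 2 * (3 * x - y) ^ 2)"
proof -
  obtain g d where f: "g = 2 * x + y" "d = 3 * x - y" by blast
  have nz': "x > 0" "y > 0" "g > 0" "d > 0" using nz f by simp_all
  note closed = Let_def N a b f
  have m01: "moment 0 1 N = x * y * d ^ 2 / 2"
    using cassini by (simp add: moment_0_1 closed field_simps del: One_nat_def) algebra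
  have m03: "moment 0 3 N = x ^ 2 * y * d ^ 2 * (2 * x ^ 3 + 6 * x * y ^ 2 - 3 * y ^ 3) / 4"
    using cassini by (simp add: moment_0_3 closed field_simps del: One_nat_def) algebra
  have Q1: "Q golden_ratio (fib_pred N) = (2 * x ^ 3 + 6 * x * y ^ 2 - 3 * y ^ 3) / (y * d ^ 2)"
    unfolding Q_golden_ratio[OF N(1)] m01 m03 using nz'
    by (simp add: field_simps power2_eq_square power4_eq_xxxx)
  have denominator: "moment 0 1 N + moment 1 0 N = x ^ 2 * g * d / 2"
    using cassini by (simp add: moment_0_1 moment_1_0 closed field_simps del: One_nat_def) algebra
  have numerator: "moment 0 3 N + 3 * moment 1 2 N + 3 * moment 2 1 N + moment 3 0 N
      = x ^ 2 * g ^ 2 * d * (2 * x ^ 3 + 2 * x ^ 2 * y + x * y ^ 2 - y ^ 3) / 4"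
    using cassini
    by (simp add: moment_0_3 moment_1_2 moment_2_1 moment_3_0 closed field_simps del: One_nat_def) algebra
  have Q2: "Q (golden_ratio ^ 2) (fib_pred N)
      = (2 * x ^ 3 + 2 * x ^ 2 * y + x * y ^ 2 - y ^ 3) / (x ^ 2 * d)"
    unfolding Q_golden_ratio_square[OF N(1)] denominator numerator using nz'
    by (simp add: field_simps power2_eq_square)
  have "(2 * x ^ 3 + 2 * x ^ 2 * y + x * y ^ 2 - y ^ 3) * (y * d ^ 2) * (y * x ^ 2 * d ^ 2)
      - (2 * x ^ 3 + 6 * x * y ^ 2 - 3 * y ^ 3) * (x ^ 2 * d) * (y * x ^ 2 * d ^ 2)
      = (x ^ 2 * d) * (y * d ^ 2) * (y * x ^ 2 * d ^ 2 - (2 * x - y))"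
    using cassini f by algebra
  then show ?thesis
    unfolding Q1 Q2 f[symmetric] using nz' by (simp add: field_simps)
qed

lemma Q_diff_even_odd:
  fixes x y :: real
  assumes N: "N \<ge> 1" "even N"
    and b: "real (fib N) = x * (2 * y - x)" and a: "real (fib (Suc N)) = x ^ 2 + y ^ 2"
    and cassini: "y ^ 2 = x * y + x ^ 2 - 1"
    and nz: "y > 0" "2 * x + y > 0" "x + y > 0" "2 * y - x > 0" "y - x > 0"
  shows "Q (golden_ratio ^ 2) (fib_pred N) - Q golden_ratio (fib_pred N)
    = 1 - 1 / ((2 * x + y) ^ 2 * (x + y) * (y - x))"
proof -
  \<comment> \<open>Now \<open>g\<close> and \<open>c\<close> are the Lucas numbers at
    \<open>k + 1\<close> and \<open>k\<close>, while \<open>h\<close> and \<open>d\<close> are the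
    Fibonacci numbers at \<open>k + 2\<close> and \<open>k - 1\<close>.\<close>
  obtain g h c d where f: "g = 2 * x + y" "h = x + y" "c = 2 * y - x" "d = y - x" by blast
  have nz': "y > 0" "g > 0" "h > 0" "c > 0" "d > 0" using nz f by simp_all
  note closed = Let_def N a b f
  have m01: "moment 0 1 N = y * g * c * d / 2"
    using cassini by (simp add: moment_0_1 closed field_simps del: One_nat_def) algebra
  have m03: "moment 0 3 N = y ^ 2 * c ^ 4 * h * d / 4"
    using cassini by (simp add: moment_0_3 closed field_simps del: One_nat_def) algebra
  have Q1: "Q golden_ratio (fib_pred N) = (c ^ 2 * h) / (g ^ 2 * d)"
    unfolding Q_golden_ratio[OF N(1)] m01 m03 using nz'
    by (simp add: field_simps power2_eq_square power4_eq_xxxx)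
  have denominator: "moment 0 1 N + moment 1 0 N = g * c * h * d / 2"
    using cassini by (simp add: moment_0_1 moment_1_0 closed field_simps del: One_nat_def) algebra
  have numerator: "moment 0 3 N + 3 * moment 1 2 N + 3 * moment 2 1 N + moment 3 0 N
      = g * c ^ 2 * h * d * (4 * y ^ 3 + 2 * x * y ^ 2 - 3 * x ^ 2 * y - 2 * x ^ 3) / 4"
    using cassini
    by (simp add: moment_0_3 moment_1_2 moment_2_1 moment_3_0 closed field_simps del: One_nat_def) algebra
  have Q2: "Q (golden_ratio ^ 2) (fib_pred N)
      = (4 * y ^ 3 + 2 * x * y ^ 2 - 3 * x ^ 2 * y - 2 * x ^ 3) / (g * h * d)"
    unfolding Q_golden_ratio_square[OF N(1)] denominator numerator using nz'
    by (simp add: field_simps power2_eq_square)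
  have "(4 * y ^ 3 + 2 * x * y ^ 2 - 3 * x ^ 2 * y - 2 * x ^ 3) * (g ^ 2 * d) * (g ^ 2 * h * d)
      - (c ^ 2 * h) * (g * h * d) * (g ^ 2 * h * d)
      = (g * h * d) * (g ^ 2 * d) * (g ^ 2 * h * d - 1)"
    using cassini f by algebra
  then show ?thesis
    unfolding Q1 Q2 f[symmetric] using nz' by (simp add: field_simps)
qed

lemma Q_diff_odd_odd:
  fixes x y :: real
  assumes N: "N \<ge> 1" "odd N"
    and b: "real (fib N) = x ^ 2 + (y - x) ^ 2" and a: "real (fib (Suc N)) = x * (2 * y - x)"
    and cassini: "y ^ 2 = x * y + x ^ 2 - 1"
    and nz: "y > 0" "2 * x + y > 0" "2 * y - x > 0" "y - x > 0"
  shows "Q (golden_ratio ^ 2) (fib_pred N) - Q golden_ratio (fib_pred N)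
    = 1 - (3 * y - 4 * x) / ((2 * x + y) * (2 * y - x) ^ 2 * (y - x) ^ 2)"
proof -
  obtain g c d where f: "g = 2 * x + y" "c = 2 * y - x" "d = y - x" by blast
  have nz': "y > 0" "g > 0" "c > 0" "d > 0" using nz f by simp_all
  note closed = Let_def N a b f
  have m01: "moment 0 1 N = g * c * d ^ 2 / 2"
    using cassini by (simp add: moment_0_1 closed field_simps del: One_nat_def) algebra
  have m03: "moment 0 3 N = g * c ^ 2 * d ^ 2 * (y ^ 3 - 2 * x ^ 3) / 4"
    using cassini by (simp add: moment_0_3 closed field_simps del: One_nat_def) algebra
  have Q1: "Q golden_ratio (fib_pred N) = (y ^ 3 - 2 * x ^ 3) / (g * d ^ 2)"
    unfolding Q_golden_ratio[OF N(1)] m01 m03 using nz'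
    by (simp add: field_simps power2_eq_square power4_eq_xxxx)
  have denominator: "moment 0 1 N + moment 1 0 N = y * c ^ 2 * d / 2"
    using cassini by (simp add: moment_0_1 moment_1_0 closed field_simps del: One_nat_def) algebra
  have numerator: "moment 0 3 N + 3 * moment 1 2 N + 3 * moment 2 1 N + moment 3 0 N
      = y ^ 2 * c ^ 2 * d * (5 * y ^ 3 - 3 * x * y ^ 2 - 2 * x ^ 2 * y - 2 * x ^ 3) / 4"
    using cassini
    by (simp add: moment_0_3 moment_1_2 moment_2_1 moment_3_0 closed field_simps del: One_nat_def) algebra
  have Q2: "Q (golden_ratio ^ 2) (fib_pred N)
      = (5 * y ^ 3 - 3 * x * y ^ 2 - 2 * x ^ 2 * y - 2 * x ^ 3) / (c ^ 2 * d)"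
    unfolding Q_golden_ratio_square[OF N(1)] denominator numerator using nz'
    by (simp add: field_simps power2_eq_square)
  have "(5 * y ^ 3 - 3 * x * y ^ 2 - 2 * x ^ 2 * y - 2 * x ^ 3) * (g * d ^ 2) * (g * c ^ 2 * d ^ 2)
      - (y ^ 3 - 2 * x ^ 3) * (c ^ 2 * d) * (g * c ^ 2 * d ^ 2)
      = (c ^ 2 * d) * (g * d ^ 2) * (g * c ^ 2 * d ^ 2 - (3 * y - 4 * x))"
    using cassini f by algebra
  then show ?thesis
    unfolding Q1 Q2 f[symmetric] using nz' by (simp add: field_simps)
qed

section \<open>Index duplication and assembly of the four cases\<close>

lemma fib_double:
  "real (fib (2 * n)) = real (fib n) * (2 * real (fib (Suc n)) - real (fib n))"
  "real (fib (Suc (2 * n))) = real (fib n) ^ 2 + real (fib (Suc n)) ^ 2"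
proof (induction n)
  case (Suc n)
  { case 1 then show ?case using Suc by (simp add: power2_eq_square algebra_simps) }
  { case 2 then show ?case using Suc by (simp add: power2_eq_square algebra_simps) }
qed simp_all

text \<open>This is L_n = F_(n+1) + F_(n-1) with F_(n-1) eliminated, so that \<open>n = 0\<close> is
  covered.\<close>

lemma lucas_fib: "real (lucas n) = 2 * real (fib (Suc n)) - real (fib n)"
  by (induction n rule: lucas.induct) simp_all

theorem theorem1:
  fixes k :: nat
  assumes "k \<ge> 2"
  shows
    "Q (golden_ratio ^ 2) (fib_pred (2 * k)) - Q golden_ratio (fib_pred (2 * k)) =
       (if even k
        then 1 - 1 / (real (fib (k + 1)) ^ 2 * real (lucas (k + 2)) * real (lucas (k - 1)))
        else 1 - 1 / (real (lucas (k + 1)) ^ 2 * real (fib (k + 2)) * real (fib (k - 1))))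
     \<and>
     Q (golden_ratio ^ 2) (fib_pred (2 * k - 1)) - Q golden_ratio (fib_pred (2 * k - 1)) =
       (if even k
        then 1 - real (fib (k - 2)) / (real (fib (k + 1)) * real (fib k) ^ 2 * real (lucas (k - 1)) ^ 2)
        else 1 - real (lucas (k - 2)) / (real (lucas (k + 1)) * real (lucas k) ^ 2 * real (fib (k - 1)) ^ 2))"
proof -
  \<comment> \<open>Makes the natural subtractions \<open>k - 1\<close> and \<open>k - 2\<close>
    exact.\<close>
  obtain j where k: "k = Suc (Suc j)" using assms by (metis add_2_eq_Suc le_Suc_ex)
  define x y where "x = real (fib k)" and "y = real (fib (Suc k))"
  note xy = x_def y_def
  have "fib (Suc j) > 0" by (simp add: fib_neq_0_nat)
  then have pos: "x > 0" "y > 0" "y - x > 0" "2 * x + y > 0" "x + 3 * y > 0" "3 * x - y > 0"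
    "x + y > 0" "2 * y - x > 0"
    unfolding xy k by simp_all
  have N: "2 * k \<ge> 1" "even (2 * k)" "2 * k - 1 \<ge> 1" "odd (2 * k - 1)" "Suc (2 * k - 1) = 2 * k"
    using k by simp_all
  have fib_2k: "real (fib (2 * k)) = x * (2 * y - x)" "real (fib (Suc (2 * k))) = x ^ 2 + y ^ 2"
    unfolding xy by (rule fib_double)+
  have "fib (Suc (2 * k)) = fib (2 * k) + fib (2 * k - 1)" unfolding k by simp
  then have fib_2k_1: "real (fib (2 * k - 1)) = x ^ 2 + (y - x) ^ 2"
    using fib_2k by (simp add: power2_eq_square algebra_simps)
  have cassini: "y ^ 2 = x * y + x ^ 2 + (-1) ^ k" unfolding xy by (rule fib_cassini_real)
  \<comment> \<open>Every Fibonacci or Lucas number with index near \<open>k\<close> is linear in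
    \<open>x\<close> and \<open>y\<close>.\<close>
  have indices: "real (fib (k + 1)) = y" "real (fib k) = x" "real (fib (k + 2)) = x + y"
    "real (fib (k - 1)) = y - x" "real (fib (k - 2)) = 2 * x - y"
    "real (lucas (k + 1)) = 2 * x + y" "real (lucas k) = 2 * y - x"
    "real (lucas (k + 2)) = x + 3 * y" "real (lucas (k - 1)) = 3 * x - y"
    "real (lucas (k - 2)) = 3 * y - 4 * x"
    unfolding xy k by (simp_all add: lucas_fib)
  show ?thesis
  proof (cases "even k")
    case True
    then have "y ^ 2 = x * y + x ^ 2 + 1" using cassini by simp
    then show ?thesis
      unfolding indices if_P[OF True]
      using Q_diff_even_even[of "2 * k" x y] Q_diff_odd_even[of "2 * k - 1" x y] N fib_2k fib_2k_1 pos
      by simp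
  next
    case False
    then have "y ^ 2 = x * y + x ^ 2 - 1" using cassini by simp
    then show ?thesis
      unfolding indices if_not_P[OF False]
      using Q_diff_even_odd[of "2 * k" x y] Q_diff_odd_odd[of "2 * k - 1" x y] N fib_2k fib_2k_1 pos
      by simp
  qed
qed

end
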